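(* Let $(R,V)$ be a generalized root system with a base $S$, let $I\subset S$, and let $\pi_I:V\to(\operatorname{span}I)^\perp$ be the orthogonal projection. For $\nu\in R/I:=\pi_I(R)$ let $R^\nu:=\{\beta\in R:\pi_I(\beta)=\nu\}$, considered as a partially ordered set with the order inherited from $(R,\prec_S)$. If $\nu\in R/I$, then the Hasse diagram of $R^\nu$ is connected. If, in addition, $\nu\ne0$, then $R^\nu$ contains a smallest and a largest element.
   Context: A generalized root system (GRS) is a pair $(R,V)$ where $V$ is a finite-dimensional Euclidean space and $R\subset V$ is a non-empty finite set such that: (i) $V=\operatorname{span} R$; (ii) for all $\alpha,\beta\in R$: if $\langle\alpha,\beta\rangle<0$ then $\alpha+\beta\in R$; if $\langle\alpha,\beta\rangle>0$ then $\alpha-\beta\in R$; if $\langle\alpha,\beta\rangle=0$ then $\alpha+\beta\in R$ if and only if $\alpha-\beta\in R$. (It follows that $0\in R$ and $R=-R$.) A base of $R$ is a subset $S\subset R$ which is a basis of $V$ and such that every $\beta\in R$ can be written $\beta=\sum_{\alpha\in S}m_\alpha\alpha$ with all $m_\alpha\in\mathbb{Z}_{\ge0}$ or all $m_\alpha\in\mathbb{Z}_{\le0}$. The partial order $\prec_S$ on $R$: $\alpha'\prec_S\beta'$ if $\beta'-\alpha'=\sum_{\alpha\in S}m_\alpha\alpha$ with $m_\alpha\in\mathbb{Z}_{\ge0}$ for every $\alpha\in S$. *)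

theory Defs
  imports "HOL-Analysis.Analysis" "Graph_Theory.Digraph_Component"
begin

text \<open>The Euclidean space \<open>V\<close> is a linear subspace of an ambient Euclidean space, so that
  the zero space (with \<open>R = {0}\<close>) is covered as well.\<close>

definition generalized_root_system :: "'a::euclidean_space set \<Rightarrow> 'a set \<Rightarrow> bool" where
  "generalized_root_system R V \<longleftrightarrow>
     subspace V \<and> finite R \<and> R \<noteq> {} \<and> R \<subseteq> V \<and> V = span R \<and>
     (\<forall>\<alpha>\<in>R. \<forall>\<beta>\<in>R.
        (\<alpha> \<bullet> \<beta> < 0 \<longrightarrow> \<alpha> + \<beta> \<in> R) \<and>
        (\<alpha> \<bullet> \<beta> > 0 \<longrightarrow> \<alpha> - \<beta> \<in> R) \<and>
        (\<alpha> \<bullet> \<beta> = 0 \<longrightarrow> (\<alpha> + \<beta> \<in> R \<longleftrightarrow> \<alpha> - \<beta> \<in> R)))"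

definition root_base :: "'a::euclidean_space set \<Rightarrow> 'a set \<Rightarrow> 'a set \<Rightarrow> bool" where
  "root_base S R V \<longleftrightarrow>
     S \<subseteq> R \<and> independent S \<and> span S = V \<and>
     (\<forall>\<beta>\<in>R. \<exists>m :: 'a \<Rightarrow> int. \<beta> = (\<Sum>\<alpha>\<in>S. of_int (m \<alpha>) *\<^sub>R \<alpha>) \<and>
        ((\<forall>\<alpha>\<in>S. m \<alpha> \<ge> 0) \<or> (\<forall>\<alpha>\<in>S. m \<alpha> \<le> 0)))"

definition root_order :: "'a::euclidean_space set \<Rightarrow> 'a set \<Rightarrow> 'a rel" where
  "root_order R S =
     {(\<alpha>', \<beta>'). \<alpha>' \<in> R \<and> \<beta>' \<in> R \<and>
        (\<exists>m :: 'a \<Rightarrow> int. (\<forall>\<alpha>\<in>S. m \<alpha> \<ge> 0) \<and>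
           \<beta>' - \<alpha>' = (\<Sum>\<alpha>\<in>S. of_int (m \<alpha>) *\<^sub>R \<alpha>))}"

definition orth_proj :: "'a::euclidean_space set \<Rightarrow> 'a \<Rightarrow> 'a" where
  "orth_proj W x = (THE p. p \<in> W \<and> x - p \<in> W\<^sup>\<bottom>)"

text \<open>The complement of \<open>span I\<close> is taken inside \<open>V\<close>.\<close>

definition quotient_proj :: "'a::euclidean_space set \<Rightarrow> 'a set \<Rightarrow> 'a \<Rightarrow> 'a" where
  "quotient_proj V I = orth_proj (V \<inter> (span I)\<^sup>\<bottom>)"

definition quotient_roots :: "'a::euclidean_space set \<Rightarrow> 'a set \<Rightarrow> 'a set \<Rightarrow> 'a set" where
  "quotient_roots R V I = quotient_proj V I ` R"

definition root_fiber :: "'a::euclidean_space set \<Rightarrow> 'a set \<Rightarrow> 'a set \<Rightarrow> 'a \<Rightarrow> 'a set" where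
  "root_fiber R V I \<nu> = {\<beta> \<in> R. quotient_proj V I \<beta> = \<nu>}"

text \<open>Arcs are the covering pairs of \<open>P\<close> under the order induced by \<open>r\<close>; the intermediate
  elements range over \<open>P\<close> only. The constant \<open>Digraph_Component.connected\<close>
  is connectedness of the underlying undirected graph.\<close>

definition hasse_diagram :: "'a set \<Rightarrow> 'a rel \<Rightarrow> 'a pair_pre_digraph" where
  "hasse_diagram P r = \<lparr> pverts = P,
     parcs = {(x, y). x \<in> P \<and> y \<in> P \<and> x \<noteq> y \<and> (x, y) \<in> r \<and>
       \<not> (\<exists>z\<in>P. z \<noteq> x \<and> z \<noteq> y \<and> (x, z) \<in> r \<and> (z, y) \<in> r)} \<rparr>"

definition smallest_in :: "'a \<Rightarrow> 'a set \<Rightarrow> 'a rel \<Rightarrow> bool" where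
  "smallest_in m P r \<longleftrightarrow> m \<in> P \<and> (\<forall>x\<in>P. (m, x) \<in> r)"

definition largest_in :: "'a \<Rightarrow> 'a set \<Rightarrow> 'a rel \<Rightarrow> bool" where
  "largest_in m P r \<longleftrightarrow> m \<in> P \<and> (\<forall>x\<in>P. (x, m) \<in> r)"

lemma orth_proj_ex1:
  fixes W :: "'a::euclidean_space set"
  assumes "subspace W"
  shows "\<exists>!p. p \<in> W \<and> x - p \<in> W\<^sup>\<bottom>"
proof -
  have W: "span W = W" using assms by (simp add: span_eq_iff)
  obtain y z where yz: "y \<in> span W" "\<And>w. w \<in> span W \<Longrightarrow> orthogonal z w" "x = y + z"
    by (rule orthogonal_subspace_decomp_exists[of W x]) blast
  have "y \<in> W" using yz(1) W by simp
  moreover have "x - y \<in> W\<^sup>\<bottom>"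
    using yz(2) W yz(3) by (simp add: orthogonal_comp_def orthogonal_commute)
  moreover have "p = q" if "p \<in> W" "x - p \<in> W\<^sup>\<bottom>" "q \<in> W" "x - q \<in> W\<^sup>\<bottom>" for p q
  proof -
    have "p - q \<in> W" using assms that by (simp add: subspace_diff)
    moreover have "(x - q) - (x - p) \<in> W\<^sup>\<bottom>"
      by (rule subspace_diff[OF subspace_orthogonal_comp that(4) that(2)])
    ultimately have "orthogonal (p - q) (p - q)"
      by (auto simp: orthogonal_comp_def)
    then show "p = q" by (simp add: orthogonal_self)
  qed
  ultimately show ?thesis by blast
qed

lemma partial_order_on_root_order:
  assumes "independent S"
  shows "partial_order_on R (root_order R S)"
proof -
  have fin: "finite S" using assms by (rule independent_imp_finite)
  have "refl_on R (root_order R S)"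
  proof (rule refl_onI)
    fix a assume "a \<in> R"
    have "(\<forall>s\<in>S. (0::int) \<le> 0) \<and> a - a = (\<Sum>s\<in>S. of_int 0 *\<^sub>R s)" by simp
    then have "\<exists>k :: 'a \<Rightarrow> int. (\<forall>s\<in>S. 0 \<le> k s) \<and> a - a = (\<Sum>s\<in>S. of_int (k s) *\<^sub>R s)"
      by (rule exI[where x = "\<lambda>s. 0"])
    with \<open>a \<in> R\<close> show "(a, a) \<in> root_order R S" by (simp add: root_order_def)
  qed
  moreover have "trans (root_order R S)"
  proof (rule transI)
    fix a b c assume ab: "(a, b) \<in> root_order R S" and bc: "(b, c) \<in> root_order R S"
    obtain m :: "'a \<Rightarrow> int" where m: "\<forall>s\<in>S. m s \<ge> 0" "b - a = (\<Sum>s\<in>S. of_int (m s) *\<^sub>R s)"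
      using ab by (auto simp: root_order_def)
    obtain n :: "'a \<Rightarrow> int" where n: "\<forall>s\<in>S. n s \<ge> 0" "c - b = (\<Sum>s\<in>S. of_int (n s) *\<^sub>R s)"
      using bc by (auto simp: root_order_def)
    have "c - a = (b - a) + (c - b)" by simp
    also have "\<dots> = (\<Sum>s\<in>S. of_int (m s + n s) *\<^sub>R s)"
      unfolding m n by (simp add: sum.distrib scaleR_left_distrib)
    finally have "(\<forall>s\<in>S. 0 \<le> m s + n s) \<and> c - a = (\<Sum>s\<in>S. of_int (m s + n s) *\<^sub>R s)"
      using m(1) n(1) by simp
    then have "\<exists>k :: 'a \<Rightarrow> int. (\<forall>s\<in>S. 0 \<le> k s) \<and> c - a = (\<Sum>s\<in>S. of_int (k s) *\<^sub>R s)"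
      by (rule exI[where x = "\<lambda>s. m s + n s"])
    moreover have "a \<in> R" "c \<in> R" using ab bc by (simp_all add: root_order_def)
    ultimately show "(a, c) \<in> root_order R S" by (simp add: root_order_def)
  qed
  moreover have "antisym (root_order R S)"
  proof (rule antisymI)
    fix a b assume ab: "(a, b) \<in> root_order R S" and ba: "(b, a) \<in> root_order R S"
    obtain m :: "'a \<Rightarrow> int" where m: "\<forall>s\<in>S. m s \<ge> 0" "b - a = (\<Sum>s\<in>S. of_int (m s) *\<^sub>R s)"
      using ab by (auto simp: root_order_def)
    obtain n :: "'a \<Rightarrow> int" where n: "\<forall>s\<in>S. n s \<ge> 0" "a - b = (\<Sum>s\<in>S. of_int (n s) *\<^sub>R s)"
      using ba by (auto simp: root_order_def)
    have "(\<Sum>s\<in>S. of_int (m s + n s) *\<^sub>R s) = (b - a) + (a - b)"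
      unfolding m n by (simp add: sum.distrib scaleR_left_distrib)
    then have "(\<Sum>s\<in>S. (of_int (m s + n s) :: real) *\<^sub>R s) = 0" by simp
    then have "\<forall>s\<in>S. (of_int (m s + n s) :: real) = 0"
      using independentD[OF assms fin subset_refl, where u = "\<lambda>s. of_int (m s + n s)"] by simp
    then have "\<forall>s\<in>S. m s = 0"
      using m(1) n(1) by (metis of_int_eq_0_iff add_nonneg_eq_0_iff)
    then have "b - a = 0" using m(2) by simp
    then show "a = b" by simp
  qed
  moreover have "root_order R S \<subseteq> R \<times> R" by (auto simp: root_order_def)
  ultimately show ?thesis
    by (simp add: partial_order_on_def preorder_on_def)
qed

end

theory Submission
  imports Defs
begin

text \<open>
  Two elements \<open>\<beta>, \<beta>'\<close> of a fibre differ by an integral combination of \<open>I\<close>, and a fibre is the set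
  of roots in an affine subspace \<open>\<nu> + span I\<close> with \<open>\<nu>\<close> orthogonal to \<open>I\<close>. The idea is to move
  around in a fibre by adding and subtracting single elements of \<open>I\<close>; each such move is an edge of
  the Hasse diagram, because a simple root is not a sum of two nonzero combinations of simple roots
  with nonnegative integral coefficients.

  Let \<open>\<nu> \<noteq> 0\<close>. Any element of the fibre descends by such moves to one, \<open>\<mu>\<close>, that is terminal:
  \<open>\<mu> - \<alpha>\<close> is a root for no \<open>\<alpha> \<in> I\<close>. There is only one terminal element, and it is therefore both
  the smallest element and a hub to which all others are connected. Uniqueness is a version for root
  systems of the uniqueness of the lowest weight, and has two ingredients.

  \<^item> A terminal \<open>\<mu>\<close> satisfies \<open>\<mu> \<bullet> \<alpha> \<le> 0\<close> for \<open>\<alpha> \<in> I\<close>. As the elements of \<open>I\<close> form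
    pairwise nonacute angles, two antidominant vectors of \<open>span I\<close> have a nonnegative inner product
    (\<open>dominant_inner_nonneg\<close>). Hence \<open>\<mu> \<bullet> \<mu>' \<ge> \<nu> \<bullet> \<nu> > 0\<close> for terminal \<open>\<mu>, \<mu>'\<close>, so
    \<open>\<mu> - \<mu>'\<close> is a root, positive or negative, in \<open>span I\<close>.
  \<^item> If \<open>\<mu>\<close> and \<open>\<mu> - \<gamma>\<close> are roots for a nonzero positive root \<open>\<gamma>\<close> in \<open>span I\<close>, then \<open>\<mu>\<close> is not
    terminal (\<open>not_terminal\<close>): a big step \<open>\<gamma> = \<gamma>\<^sub>1 + \<gamma>\<^sub>2\<close> can be refined to two
    smaller ones (\<open>split_step\<close>).

  Negation exchanges the fibres over \<open>\<nu>\<close> and \<open>-\<nu>\<close> and reverses the order, which yields the largest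
  element. In the fibre over \<open>0\<close>, every root is connected with the element \<open>0\<close> instead.
\<close>

section \<open>Nonnegative integral combinations\<close>

definition nat_cone :: "'a::real_vector set \<Rightarrow> 'a set" where
  "nat_cone B = {x. \<exists>m :: 'a \<Rightarrow> int. (\<forall>b\<in>B. m b \<ge> 0) \<and> x = (\<Sum>b\<in>B. of_int (m b) *\<^sub>R b)}"

lemma nat_coneI:
  assumes "\<And>b. b \<in> B \<Longrightarrow> m b \<ge> (0::int)" "x = (\<Sum>b\<in>B. of_int (m b) *\<^sub>R b)"
  shows "x \<in> nat_cone B"
  using assms unfolding nat_cone_def by blast

lemma nat_coneE:
  assumes "x \<in> nat_cone B"
  obtains m :: "'a::real_vector \<Rightarrow> int"
  where "\<And>b. b \<in> B \<Longrightarrow> m b \<ge> 0" "x = (\<Sum>b\<in>B. of_int (m b) *\<^sub>R b)"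
  using assms unfolding nat_cone_def by blast

lemma zero_in_nat_cone: "0 \<in> nat_cone B"
  by (rule nat_coneI[where m = "\<lambda>_. 0"]) auto

lemma base_in_nat_cone:
  assumes "finite B" "a \<in> B"
  shows "a \<in> nat_cone B"
proof (rule nat_coneI[where m = "\<lambda>b. if b = a then 1 else 0"])
  have "(\<Sum>b\<in>B. real_of_int (if b = a then 1 else 0) *\<^sub>R b) = (\<Sum>b\<in>B. if b = a then a else 0)"
    by (rule sum.cong) auto
  with assms show "a = (\<Sum>b\<in>B. real_of_int (if b = a then 1 else 0) *\<^sub>R b)" by simp
qed auto

lemma nat_cone_add:
  assumes "x \<in> nat_cone B" "y \<in> nat_cone B"
  shows "x + y \<in> nat_cone B"
proof -
  obtain m :: "'a \<Rightarrow> int" where m: "\<And>b. b \<in> B \<Longrightarrow> m b \<ge> 0" "x = (\<Sum>b\<in>B. of_int (m b) *\<^sub>R b)"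
    using assms(1) by (elim nat_coneE) blast
  obtain n :: "'a \<Rightarrow> int" where n: "\<And>b. b \<in> B \<Longrightarrow> n b \<ge> 0" "y = (\<Sum>b\<in>B. of_int (n b) *\<^sub>R b)"
    using assms(2) by (elim nat_coneE) blast
  show ?thesis
    by (rule nat_coneI[where m = "\<lambda>b. m b + n b"])
      (use m n in \<open>auto simp: sum.distrib scaleR_left_distrib\<close>)
qed

lemma nat_cone_mono:
  assumes "finite B" "A \<subseteq> B"
  shows "nat_cone A \<subseteq> nat_cone B"
proof
  fix x assume "x \<in> nat_cone A"
  then obtain m :: "'a \<Rightarrow> int"
    where m: "\<And>b. b \<in> A \<Longrightarrow> m b \<ge> 0" "x = (\<Sum>b\<in>A. of_int (m b) *\<^sub>R b)"
    by (elim nat_coneE) blast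
  have "(\<Sum>b\<in>A. of_int (m b) *\<^sub>R b) = (\<Sum>b\<in>B. of_int (if b \<in> A then m b else 0) *\<^sub>R b)"
    using assms by (intro sum.mono_neutral_cong_left) auto
  with m show "x \<in> nat_cone B"
    by (intro nat_coneI[where m = "\<lambda>b. if b \<in> A then m b else 0"]) auto
qed

lemma nat_cone_subset_span: "nat_cone B \<subseteq> span B"
proof
  fix x assume "x \<in> nat_cone B"
  then obtain m :: "'a \<Rightarrow> int" where "x = (\<Sum>b\<in>B. of_int (m b) *\<^sub>R b)"
    by (elim nat_coneE) blast
  then show "x \<in> span B" by (auto intro: span_sum span_scale span_base)
qed

lemma root_order_iff:
  "(x, y) \<in> root_order R S \<longleftrightarrow> x \<in> R \<and> y \<in> R \<and> y - x \<in> nat_cone S"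
  by (auto simp: root_order_def nat_cone_def)

definition height :: "'a::real_vector set \<Rightarrow> 'a \<Rightarrow> real" where
  "height B = (SOME h. linear h \<and> (\<forall>b\<in>B. h b = 1))"

lemma
  assumes "independent B"
  shows linear_height: "linear (height B)"
    and height_base: "b \<in> B \<Longrightarrow> height B b = 1"
proof -
  have "\<exists>h :: 'a \<Rightarrow> real. linear h \<and> (\<forall>b\<in>B. h b = 1)"
    using linear_independent_extend[OF assms, of "\<lambda>_. 1"] by auto
  from someI_ex[OF this] show "linear (height B)" "b \<in> B \<Longrightarrow> height B b = 1"
    by (auto simp: height_def)
qed

lemma height_nat_cone:
  assumes B: "independent B" "finite B" and x: "x \<in> nat_cone B"
  shows "x = 0 \<or> height B x \<ge> 1"
proof -
  obtain m :: "'a \<Rightarrow> int" where m: "\<And>b. b \<in> B \<Longrightarrow> m b \<ge> 0" "x = (\<Sum>b\<in>B. of_int (m b) *\<^sub>R b)"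
    using x by (elim nat_coneE) blast
  have "height B x = (\<Sum>b\<in>B. of_int (m b) * height B b)"
    unfolding m(2) by (simp add: linear_sum[OF linear_height] linear_cmul[OF linear_height] B)
  also have "\<dots> = of_int (\<Sum>b\<in>B. m b)"
    by (simp add: height_base B)
  finally have h: "height B x = of_int (\<Sum>b\<in>B. m b)" .
  show ?thesis
  proof (cases "(\<Sum>b\<in>B. m b) = 0")
    case True
    then have "\<forall>b\<in>B. m b = 0"
      using m(1) B(2) sum_nonneg_eq_0_iff[of B m] by auto
    then show ?thesis using m(2) by simp
  next
    case False
    moreover have "(\<Sum>b\<in>B. m b) \<ge> 0" using m(1) by (rule sum_nonneg)
    ultimately show ?thesis unfolding h by linarith
  qed
qed

text \<open>Simple roots are the atoms of the cone, by comparison of heights.\<close>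

lemma nat_cone_atom:
  assumes B: "independent B" "finite B" and xy: "x \<in> nat_cone B" "y \<in> nat_cone B" "x + y \<in> B"
  shows "x = 0 \<or> y = 0"
proof -
  have "height B x + height B y = 1"
    using height_base[OF B(1) xy(3)] linear_add[OF linear_height[OF B(1)]] by simp
  with height_nat_cone[OF B xy(1)] height_nat_cone[OF B xy(2)] show ?thesis by auto
qed

section \<open>Obtuse bases\<close>

text \<open>
  In a basis of pairwise nonacute vectors, dominant vectors have nonnegative coefficients: with
  \<open>x = p - n\<close> the decomposition into the positive and the negative part,
  \<open>0 \<le> x \<bullet> n = p \<bullet> n - n \<bullet> n \<le> - n \<bullet> n\<close>, so that \<open>n = 0\<close>.
\<close>

lemma dominant_inner_nonneg:
  fixes x y :: "'a::real_inner"
  assumes fin: "finite B"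
    and obtuse: "\<And>a b. a \<in> B \<Longrightarrow> b \<in> B \<Longrightarrow> a \<noteq> b \<Longrightarrow> a \<bullet> b \<le> 0"
    and x: "x \<in> span B" "\<And>b. b \<in> B \<Longrightarrow> x \<bullet> b \<ge> 0"
    and y: "\<And>b. b \<in> B \<Longrightarrow> y \<bullet> b \<ge> 0"
  shows "x \<bullet> y \<ge> 0"
proof -
  obtain c where c: "x = (\<Sum>b\<in>B. c b *\<^sub>R b)"
    using x(1) span_finite[OF fin] by auto
  define p where "p = (\<Sum>b\<in>B. max (c b) 0 *\<^sub>R b)"
  define n where "n = (\<Sum>b\<in>B. max (- c b) 0 *\<^sub>R b)"
  have "max r 0 - max (- r) 0 = r" for r :: real by auto
  then have xpn: "x = p - n"
    unfolding c p_def n_def by (simp flip: sum_subtractf scaleR_left_diff_distrib)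
  have "p \<bullet> n \<le> 0"
    unfolding p_def n_def inner_sum_left inner_sum_right
  proof (intro sum_nonpos)
    fix a b assume ab: "a \<in> B" "b \<in> B"
    show "max (c b) 0 *\<^sub>R b \<bullet> (max (- c a) 0 *\<^sub>R a) \<le> 0"
    proof (cases "a = b")
      case False
      then have "max (c b) 0 * max (- c a) 0 * (b \<bullet> a) \<le> 0"
        using obtuse ab by (intro mult_nonneg_nonpos) auto
      then show ?thesis by (simp add: mult_ac)
    qed (auto simp: max_def)
  qed
  moreover have "x \<bullet> n \<ge> 0"
    unfolding n_def inner_sum_right using x(2) by (auto intro!: sum_nonneg)
  ultimately have "n \<bullet> n \<le> 0" unfolding xpn by (simp add: inner_diff_left)
  then have "n = 0" using inner_gt_zero_iff[of n] by linarith
  then have "x = p" using xpn by simp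
  moreover have "p \<bullet> y \<ge> 0"
    unfolding p_def inner_sum_left using y by (auto intro!: sum_nonneg simp: inner_commute)
  ultimately show ?thesis by simp
qed

section \<open>Roots with a base\<close>

text \<open>
  Descent by simple roots lowers the height. In a fibre the height may become negative, but as there
  are only finitely many roots, it cannot decrease forever.
\<close>

lemma finite_induct_smaller [consumes 2, case_names less]:
  fixes h :: "'a \<Rightarrow> real"
  assumes "finite R" "x \<in> R"
    and less: "\<And>x. x \<in> R \<Longrightarrow> (\<And>y. y \<in> R \<Longrightarrow> h y < h x \<Longrightarrow> P y) \<Longrightarrow> P x"
  shows "P x"
  using assms(2)
proof (induction "card {y \<in> R. h y < h x}" arbitrary: x rule: less_induct)
  case less
  show ?case
  proof (rule assms(3)[OF less.prems])
    fix y assume y: "y \<in> R" "h y < h x"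
    then have "{z \<in> R. h z < h y} \<subset> {z \<in> R. h z < h x}" by auto
    then have "card {z \<in> R. h z < h y} < card {z \<in> R. h z < h x}"
      using assms(1) by (intro psubset_card_mono) auto
    then show "P y" using y(1) by (rule less.hyps)
  qed
qed

locale based_root_system =
  fixes R V S I :: "'a::euclidean_space set"
  assumes grs: "generalized_root_system R V"
    and base: "root_base S R V"
    and I_subset: "I \<subseteq> S"
begin

lemma finite_R: "finite R" and span_R: "span R = V"
  using grs by (auto simp: generalized_root_system_def)

lemma S_subset: "S \<subseteq> R" and independent_S: "independent S" and span_S: "span S = V"
  using base by (auto simp: root_base_def)

lemma finite_S: "finite S" and finite_I: "finite I"
  using finite_R S_subset I_subset by (auto intro: finite_subset)

lemma I_in_S: "\<alpha> \<in> I \<Longrightarrow> \<alpha> \<in> S" and I_in_R: "\<alpha> \<in> I \<Longrightarrow> \<alpha> \<in> R"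
  using I_subset S_subset by auto

lemma root_add: "\<alpha> \<in> R \<Longrightarrow> \<beta> \<in> R \<Longrightarrow> \<alpha> \<bullet> \<beta> < 0 \<Longrightarrow> \<alpha> + \<beta> \<in> R"
  and root_diff: "\<alpha> \<in> R \<Longrightarrow> \<beta> \<in> R \<Longrightarrow> \<alpha> \<bullet> \<beta> > 0 \<Longrightarrow> \<alpha> - \<beta> \<in> R"
  and root_add_iff_diff: "\<alpha> \<in> R \<Longrightarrow> \<beta> \<in> R \<Longrightarrow> \<alpha> \<bullet> \<beta> = 0 \<Longrightarrow> \<alpha> + \<beta> \<in> R \<longleftrightarrow> \<alpha> - \<beta> \<in> R"
  using grs by (auto simp: generalized_root_system_def)

lemma zero_root: "0 \<in> R"
proof -
  obtain \<alpha> where \<alpha>: "\<alpha> \<in> R" using grs by (auto simp: generalized_root_system_def)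
  show ?thesis
  proof (cases "\<alpha> = 0")
    case False
    then show ?thesis using root_diff[OF \<alpha> \<alpha>] by simp
  qed (use \<alpha> in simp)
qed

lemma uminus_root: "\<alpha> \<in> R \<Longrightarrow> - \<alpha> \<in> R"
  using root_add_iff_diff[OF zero_root, of \<alpha>] by simp

text \<open>
  The coefficients of a root of \<open>span I\<close> outside \<open>I\<close> vanish, since \<open>S\<close> is independent; the sign
  condition on the base \<open>S\<close> is thus inherited by \<open>I\<close>.
\<close>

lemma root_sign:
  assumes "\<beta> \<in> R" "\<beta> \<in> span I"
  shows "\<beta> \<in> nat_cone I \<or> - \<beta> \<in> nat_cone I"
proof -
  obtain m :: "'a \<Rightarrow> int" where m: "\<beta> = (\<Sum>\<alpha>\<in>S. of_int (m \<alpha>) *\<^sub>R \<alpha>)"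
    and sign: "(\<forall>\<alpha>\<in>S. m \<alpha> \<ge> 0) \<or> (\<forall>\<alpha>\<in>S. m \<alpha> \<le> 0)"
    using base assms(1) unfolding root_base_def by blast
  obtain c where c: "\<beta> = (\<Sum>\<alpha>\<in>I. c \<alpha> *\<^sub>R \<alpha>)"
    using assms(2) span_finite[OF finite_I] by auto
  have "\<beta> = (\<Sum>\<alpha>\<in>S. (if \<alpha> \<in> I then c \<alpha> else 0) *\<^sub>R \<alpha>)"
    unfolding c using I_subset finite_S by (intro sum.mono_neutral_cong_left) auto
  then have "(\<Sum>\<alpha>\<in>S. (of_int (m \<alpha>) - (if \<alpha> \<in> I then c \<alpha> else 0)) *\<^sub>R \<alpha>) = 0"
    using m by (simp add: scaleR_left_diff_distrib sum_subtractf)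
  then have "of_int (m \<alpha>) - (if \<alpha> \<in> I then c \<alpha> else 0) = 0" if "\<alpha> \<in> S" for \<alpha>
    using independentD[OF independent_S finite_S subset_refl _ that,
        of "\<lambda>\<alpha>. of_int (m \<alpha>) - (if \<alpha> \<in> I then c \<alpha> else 0)"] by simp
  then have off_I: "m \<alpha> = 0" if "\<alpha> \<in> S" "\<alpha> \<notin> I" for \<alpha> using that by fastforce
  have mI: "\<beta> = (\<Sum>\<alpha>\<in>I. of_int (m \<alpha>) *\<^sub>R \<alpha>)"
    unfolding m using I_subset finite_S off_I by (intro sum.mono_neutral_right) auto
  from sign show ?thesis
  proof
    assume "\<forall>\<alpha>\<in>S. m \<alpha> \<ge> 0"
    then have "\<beta> \<in> nat_cone I"
      using mI I_in_S by (intro nat_coneI[where m = m]) auto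
    then show ?thesis ..
  next
    assume "\<forall>\<alpha>\<in>S. m \<alpha> \<le> 0"
    then have "- \<beta> \<in> nat_cone I"
      using mI I_in_S by (intro nat_coneI[where m = "\<lambda>\<alpha>. - m \<alpha>"]) (auto simp: sum_negf)
    then show ?thesis ..
  qed
qed

text \<open>Otherwise \<open>\<alpha> - \<beta>\<close> would be a root with one positive and one negative coefficient.\<close>

lemma simple_roots_obtuse:
  assumes "\<alpha> \<in> S" "\<beta> \<in> S" "\<alpha> \<noteq> \<beta>"
  shows "\<alpha> \<bullet> \<beta> \<le> 0"
proof (rule ccontr)
  assume "\<not> \<alpha> \<bullet> \<beta> \<le> 0"
  then have "\<alpha> - \<beta> \<in> R" using root_diff assms(1,2) S_subset by (simp add: subset_iff)
  then obtain m :: "'a \<Rightarrow> int" where m: "\<alpha> - \<beta> = (\<Sum>\<gamma>\<in>S. of_int (m \<gamma>) *\<^sub>R \<gamma>)"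
    and sign: "(\<forall>\<gamma>\<in>S. m \<gamma> \<ge> 0) \<or> (\<forall>\<gamma>\<in>S. m \<gamma> \<le> 0)"
    using base unfolding root_base_def by blast
  define e :: "'a \<Rightarrow> 'a \<Rightarrow> real" where "e \<delta> \<gamma> = (if \<gamma> = \<delta> then 1 else 0)" for \<delta> \<gamma>
  have e: "(\<Sum>\<gamma>\<in>S. e \<delta> \<gamma> *\<^sub>R \<gamma>) = \<delta>" if "\<delta> \<in> S" for \<delta>
  proof -
    have "(\<Sum>\<gamma>\<in>S. e \<delta> \<gamma> *\<^sub>R \<gamma>) = (\<Sum>\<gamma>\<in>S. if \<gamma> = \<delta> then \<delta> else 0)"
      by (rule sum.cong) (auto simp: e_def)
    with that finite_S show ?thesis by simp
  qed
  have "(\<Sum>\<gamma>\<in>S. (of_int (m \<gamma>) - e \<alpha> \<gamma> + e \<beta> \<gamma>) *\<^sub>R \<gamma>)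
      = (\<alpha> - \<beta>) - (\<Sum>\<gamma>\<in>S. e \<alpha> \<gamma> *\<^sub>R \<gamma>) + (\<Sum>\<gamma>\<in>S. e \<beta> \<gamma> *\<^sub>R \<gamma>)"
    unfolding m by (simp add: scaleR_left_diff_distrib scaleR_left_distrib sum.distrib sum_subtractf)
  also have "\<dots> = 0" using assms e by simp
  finally have "of_int (m \<gamma>) - e \<alpha> \<gamma> + e \<beta> \<gamma> = 0" if "\<gamma> \<in> S" for \<gamma>
    using independentD[OF independent_S finite_S subset_refl _ that,
        of "\<lambda>\<gamma>. of_int (m \<gamma>) - e \<alpha> \<gamma> + e \<beta> \<gamma>"] by simp
  from this[of \<alpha>] this[of \<beta>] assms have "m \<alpha> = 1" "m \<beta> = -1" by (simp_all add: e_def)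
  with sign assms show False by force
qed

text \<open>
  Since \<open>\<gamma> \<bullet> \<gamma> > 0\<close>, some simple root \<open>\<alpha>\<close> occurring in \<open>\<gamma>\<close> has \<open>\<gamma> \<bullet> \<alpha> > 0\<close>; subtracting it
  leaves a root, and lowers a coefficient which is at least \<open>1\<close>.
\<close>

lemma positive_root_descent:
  assumes "\<gamma> \<in> R" "\<gamma> \<in> nat_cone I" "\<gamma> \<noteq> 0"
  obtains \<alpha> where "\<alpha> \<in> I" "\<gamma> - \<alpha> \<in> R" "\<gamma> - \<alpha> \<in> nat_cone I"
proof -
  obtain m :: "'a \<Rightarrow> int" where m: "\<And>\<alpha>. \<alpha> \<in> I \<Longrightarrow> m \<alpha> \<ge> 0" "\<gamma> = (\<Sum>\<alpha>\<in>I. of_int (m \<alpha>) *\<^sub>R \<alpha>)"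
    using assms(2) by (elim nat_coneE) blast
  have "\<exists>\<alpha>\<in>I. of_int (m \<alpha>) * (\<gamma> \<bullet> \<alpha>) > 0"
  proof (rule ccontr)
    assume "\<not> ?thesis"
    then have "(\<Sum>\<alpha>\<in>I. of_int (m \<alpha>) * (\<gamma> \<bullet> \<alpha>)) \<le> 0" by (intro sum_nonpos) (auto simp: not_less)
    also have "(\<Sum>\<alpha>\<in>I. of_int (m \<alpha>) * (\<gamma> \<bullet> \<alpha>)) = \<gamma> \<bullet> (\<Sum>\<alpha>\<in>I. of_int (m \<alpha>) *\<^sub>R \<alpha>)"
      by (simp add: inner_sum_right)
    finally have "\<gamma> \<bullet> \<gamma> \<le> 0" using m(2) by simp
    then show False using assms(3) inner_gt_zero_iff[of \<gamma>] by linarith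
  qed
  then obtain \<alpha> where \<alpha>: "\<alpha> \<in> I" "of_int (m \<alpha>) * (\<gamma> \<bullet> \<alpha>) > 0" by blast
  then have "m \<alpha> \<ge> 1" "\<gamma> \<bullet> \<alpha> > 0"
    using m(1)[OF \<alpha>(1)] by (auto simp: zero_less_mult_iff)
  have "(\<Sum>\<beta>\<in>I. real_of_int (if \<beta> = \<alpha> then 1 else 0) *\<^sub>R \<beta>) = (\<Sum>\<beta>\<in>I. if \<beta> = \<alpha> then \<alpha> else 0)"
    by (rule sum.cong) auto
  then have "\<gamma> - \<alpha> = (\<Sum>\<beta>\<in>I. of_int (m \<beta> - (if \<beta> = \<alpha> then 1 else 0)) *\<^sub>R \<beta>)"
    using m(2) \<alpha>(1) finite_I by (simp add: scaleR_left_diff_distrib sum_subtractf)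
  then have "\<gamma> - \<alpha> \<in> nat_cone I"
    by (intro nat_coneI[where m = "\<lambda>\<beta>. m \<beta> - (if \<beta> = \<alpha> then 1 else 0)"])
      (use m(1) \<open>m \<alpha> \<ge> 1\<close> in auto)
  moreover have "\<gamma> - \<alpha> \<in> R"
    using root_diff[OF assms(1) I_in_R[OF \<alpha>(1)]] \<open>\<gamma> \<bullet> \<alpha> > 0\<close> by simp
  ultimately show ?thesis using \<alpha>(1) that by blast
qed

text \<open>
  If neither intermediate point were a root, the closure properties at \<open>\<mu>\<close> and at \<open>\<mu> - \<gamma>\<close>, where
  \<open>\<gamma> = \<gamma>\<^sub>1 + \<gamma>\<^sub>2\<close>, would give \<open>\<mu> \<bullet> \<gamma> \<le> 0\<close> and \<open>(\<mu> - \<gamma>) \<bullet> \<gamma> \<ge> 0\<close>, so \<open>\<gamma> \<bullet> \<gamma> \<le> 0\<close>.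
\<close>

lemma split_step:
  assumes \<mu>: "\<mu> \<in> R" "\<mu> - (\<gamma>\<^sub>1 + \<gamma>\<^sub>2) \<in> R" and "\<gamma>\<^sub>1 \<in> R" "\<gamma>\<^sub>2 \<in> R" "\<gamma>\<^sub>1 + \<gamma>\<^sub>2 \<noteq> 0"
  shows "\<mu> - \<gamma>\<^sub>1 \<in> R \<or> \<mu> - \<gamma>\<^sub>2 \<in> R"
proof (rule ccontr)
  assume no: "\<not> ?thesis"
  let ?\<gamma> = "\<gamma>\<^sub>1 + \<gamma>\<^sub>2"
  have "\<mu> \<bullet> \<gamma>\<^sub>1 \<le> 0" "\<mu> \<bullet> \<gamma>\<^sub>2 \<le> 0"
    using no root_diff[OF \<mu>(1)] assms(3,4) by force+
  then have "\<mu> \<bullet> ?\<gamma> \<le> 0" by (simp add: inner_add_right)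
  moreover have "(\<mu> - ?\<gamma>) \<bullet> \<gamma>\<^sub>1 \<ge> 0" "(\<mu> - ?\<gamma>) \<bullet> \<gamma>\<^sub>2 \<ge> 0"
    using no root_add[OF \<mu>(2) assms(3)] root_add[OF \<mu>(2) assms(4)] by (force simp: not_le)+
  then have "(\<mu> - ?\<gamma>) \<bullet> ?\<gamma> \<ge> 0" by (simp add: inner_add_right)
  ultimately have "?\<gamma> \<bullet> ?\<gamma> \<le> 0" by (simp add: inner_diff_left)
  then show False using assms(5) inner_gt_zero_iff[of ?\<gamma>] by linarith
qed

text \<open>Splitting off simple roots from \<open>\<gamma>\<close> refines the step from \<open>\<mu>\<close> to \<open>\<mu> - \<gamma>\<close>.\<close>

lemma not_terminal:
  assumes "\<gamma> \<in> R" "\<gamma> \<in> nat_cone I" "\<gamma> \<noteq> 0" "\<mu> \<in> R" "\<mu> - \<gamma> \<in> R"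
  shows "\<exists>\<alpha>\<in>I. \<mu> - \<alpha> \<in> R"
  using finite_R assms(1) assms(2,3,5)
proof (induction \<gamma> rule: finite_induct_smaller[where h = "height S"])
  case (less \<gamma>)
  obtain \<alpha> where \<alpha>: "\<alpha> \<in> I" "\<gamma> - \<alpha> \<in> R" "\<gamma> - \<alpha> \<in> nat_cone I"
    using positive_root_descent less.hyps less.prems(1,2) by blast
  show ?case
  proof (cases "\<gamma> = \<alpha> \<or> \<mu> - \<alpha> \<in> R")
    case True
    then show ?thesis using \<alpha>(1) less.prems(3) by blast
  next
    case False
    then have "\<mu> - (\<gamma> - \<alpha>) \<in> R"
      using split_step[OF assms(4), of \<alpha> "\<gamma> - \<alpha>"] less.prems \<alpha> I_in_R by simp
    moreover have "height S (\<gamma> - \<alpha>) < height S \<gamma>"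
      using \<alpha>(1) I_in_S
      by (simp add: linear_diff[OF linear_height] height_base independent_S)
    ultimately show ?thesis using less.IH[of "\<gamma> - \<alpha>"] \<alpha> False by auto
  qed
qed

section \<open>Fibres\<close>

definition fiber :: "'a \<Rightarrow> 'a set" where
  "fiber \<nu> = {\<beta> \<in> R. \<beta> - \<nu> \<in> span I}"

definition simple_step :: "'a \<Rightarrow> 'a rel" where
  "simple_step \<nu> = {(\<beta>, \<beta>'). \<beta> \<in> fiber \<nu> \<and> \<beta>' \<in> fiber \<nu> \<and> \<beta>' - \<beta> \<in> I}"

lemma fiber_subset: "\<beta> \<in> fiber \<nu> \<Longrightarrow> \<beta> \<in> R"
  by (simp add: fiber_def)

lemma fiber_diff_span: "\<beta> \<in> fiber \<nu> \<Longrightarrow> \<beta>' \<in> fiber \<nu> \<Longrightarrow> \<beta> - \<beta>' \<in> span I"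
  using span_diff[of "\<beta> - \<nu>" I "\<beta>' - \<nu>"] by (auto simp: fiber_def)

lemma fiber_diff_simple:
  assumes "\<beta> \<in> fiber \<nu>" "\<beta> - \<alpha> \<in> R" "\<alpha> \<in> I"
  shows "\<beta> - \<alpha> \<in> fiber \<nu>"
  using assms span_diff[of "\<beta> - \<nu>" I \<alpha>] by (auto simp: fiber_def span_base algebra_simps)

lemma uminus_fiber: "\<beta> \<in> fiber \<nu> \<Longrightarrow> - \<beta> \<in> fiber (- \<nu>)"
  using span_neg[of "\<beta> - \<nu>" I] by (auto simp: fiber_def uminus_root)

lemma simple_step_star_nat_cone:
  "(\<beta>, \<beta>') \<in> (simple_step \<nu>)\<^sup>* \<Longrightarrow> \<beta>' - \<beta> \<in> nat_cone I"
proof (induction rule: rtrancl_induct)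
  case base
  show ?case by (simp add: zero_in_nat_cone)
next
  case (step \<delta> \<epsilon>)
  then have "\<epsilon> - \<delta> \<in> nat_cone I"
    by (auto simp: simple_step_def base_in_nat_cone finite_I)
  from nat_cone_add[OF step.IH this] show ?case by simp
qed

definition terminal :: "'a \<Rightarrow> bool" where
  "terminal \<mu> \<longleftrightarrow> (\<forall>\<alpha>\<in>I. \<mu> - \<alpha> \<notin> R)"

lemma descend_to_terminal:
  assumes "\<beta> \<in> fiber \<nu>"
  shows "\<exists>\<mu>\<in>fiber \<nu>. terminal \<mu> \<and> (\<mu>, \<beta>) \<in> (simple_step \<nu>)\<^sup>*"
  using finite_R fiber_subset[OF assms] assms
proof (induction \<beta> rule: finite_induct_smaller[where h = "height S"])
  case (less \<beta>)
  show ?case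
  proof (cases "terminal \<beta>")
    case False
    then obtain \<alpha> where \<alpha>: "\<alpha> \<in> I" "\<beta> - \<alpha> \<in> R" by (auto simp: terminal_def)
    have F: "\<beta> - \<alpha> \<in> fiber \<nu>" by (rule fiber_diff_simple[OF less.prems \<alpha>(2,1)])
    have "height S (\<beta> - \<alpha>) < height S \<beta>"
      using \<alpha>(1) I_in_S
      by (simp add: linear_diff[OF linear_height] height_base independent_S)
    then obtain \<mu> where "\<mu> \<in> fiber \<nu>" "terminal \<mu>" "(\<mu>, \<beta> - \<alpha>) \<in> (simple_step \<nu>)\<^sup>*"
      using less.IH[OF \<alpha>(2) _ F] by blast
    moreover have "(\<beta> - \<alpha>, \<beta>) \<in> simple_step \<nu>"
      using F less.prems \<alpha> by (auto simp: simple_step_def)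
    ultimately show ?thesis by (meson rtrancl.rtrancl_into_rtrancl)
  qed (use less.prems in auto)
qed

lemma terminal_antidominant:
  assumes "\<mu> \<in> R" "terminal \<mu>" "\<alpha> \<in> I"
  shows "\<mu> \<bullet> \<alpha> \<le> 0"
  using assms root_diff[OF assms(1) I_in_R[OF assms(3)]] by (force simp: terminal_def)

text \<open>
  The components of two terminal elements in \<open>span I\<close> are antidominant, so that their inner product
  is nonnegative. The component \<open>\<nu>\<close> contributes \<open>\<nu> \<bullet> \<nu> > 0\<close>, which makes the difference of the two
  elements a root. If it is not \<open>0\<close>, it leads down from one of them, which is then not terminal.
\<close>

lemma terminal_unique:
  assumes \<nu>: "\<nu> \<noteq> 0" "\<And>\<alpha>. \<alpha> \<in> I \<Longrightarrow> \<nu> \<bullet> \<alpha> = 0"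
    and \<mu>: "\<mu> \<in> fiber \<nu>" "terminal \<mu>" and \<mu>': "\<mu>' \<in> fiber \<nu>" "terminal \<mu>'"
  shows "\<mu> = \<mu>'"
proof -
  have R: "\<mu> \<in> R" "\<mu>' \<in> R" using \<mu> \<mu>' by (auto simp: fiber_def)
  define \<rho> where "\<rho> = \<nu> - \<mu>"
  define \<rho>' where "\<rho>' = \<nu> - \<mu>'"
  have span: "\<rho> \<in> span I" "\<rho>' \<in> span I"
    using span_neg[of "\<mu> - \<nu>" I] span_neg[of "\<mu>' - \<nu>" I] \<mu> \<mu>'
    by (auto simp: fiber_def \<rho>_def \<rho>'_def)
  have orth: "\<nu> \<bullet> x = 0" if "x \<in> span I" for x
    using that \<nu>(2) by (induction rule: span_induct_alt) (auto simp: inner_add_right)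
  have "\<rho> \<bullet> \<rho>' \<ge> 0"
  proof (rule dominant_inner_nonneg[OF finite_I])
    show "\<alpha> \<bullet> \<beta> \<le> 0" if "\<alpha> \<in> I" "\<beta> \<in> I" "\<alpha> \<noteq> \<beta>" for \<alpha> \<beta>
      using that simple_roots_obtuse I_in_S by blast
    show "\<rho> \<bullet> \<alpha> \<ge> 0" "\<rho>' \<bullet> \<alpha> \<ge> 0" if "\<alpha> \<in> I" for \<alpha>
      using terminal_antidominant[OF R(1) \<mu>(2) that] terminal_antidominant[OF R(2) \<mu>'(2) that]
        \<nu>(2)[OF that]
      by (simp_all add: \<rho>_def \<rho>'_def inner_diff_left)
  qed (rule span)
  moreover have "\<mu> \<bullet> \<mu>' = \<nu> \<bullet> \<nu> + \<rho> \<bullet> \<rho>'"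
  proof -
    have "\<mu> = \<nu> - \<rho>" "\<mu>' = \<nu> - \<rho>'" by (simp_all add: \<rho>_def \<rho>'_def)
    then show ?thesis
      using orth[OF span(1)] orth[OF span(2)]
      by (simp add: inner_diff_left inner_diff_right inner_commute)
  qed
  moreover have "\<nu> \<bullet> \<nu> > 0" using \<nu>(1) by simp
  ultimately have pos: "\<mu> \<bullet> \<mu>' > 0" by linarith
  have diff: "\<mu> - \<mu>' \<in> R" "\<mu>' - \<mu> \<in> R"
    using root_diff R pos by (auto simp: inner_commute)
  show ?thesis
  proof (rule ccontr)
    assume ne: "\<mu> \<noteq> \<mu>'"
    from root_sign[OF diff(1) fiber_diff_span[OF \<mu>(1) \<mu>'(1)]] show False
    proof
      assume "\<mu> - \<mu>' \<in> nat_cone I"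
      from not_terminal[OF diff(1) this _ R(1)] show False
        using ne R \<mu>(2) by (simp add: terminal_def)
    next
      assume "- (\<mu> - \<mu>') \<in> nat_cone I"
      then have "\<mu>' - \<mu> \<in> nat_cone I" by simp
      from not_terminal[OF diff(2) this _ R(2)] show False
        using ne R \<mu>'(2) by (simp add: terminal_def)
    qed
  qed
qed

lemma fiber_source:
  assumes "\<nu> \<noteq> 0" "\<And>\<alpha>. \<alpha> \<in> I \<Longrightarrow> \<nu> \<bullet> \<alpha> = 0" "\<beta> \<in> fiber \<nu>"
  shows "\<exists>\<mu>\<in>fiber \<nu>. \<forall>\<beta>\<in>fiber \<nu>. (\<mu>, \<beta>) \<in> (simple_step \<nu>)\<^sup>*"
proof -
  obtain \<mu> where \<mu>: "\<mu> \<in> fiber \<nu>" "terminal \<mu>"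
    using descend_to_terminal[OF assms(3)] by blast
  have "(\<mu>, \<beta>') \<in> (simple_step \<nu>)\<^sup>*" if "\<beta>' \<in> fiber \<nu>" for \<beta>'
    using descend_to_terminal[OF that] terminal_unique[OF assms(1,2) \<mu>] by blast
  with \<mu>(1) show ?thesis by blast
qed

text \<open>A positive root descends to \<open>0\<close>; the negatives of the roots on the way lead up to \<open>0\<close>.\<close>

lemma positive_root_connected_zero:
  assumes "\<beta> \<in> R" "\<beta> \<in> nat_cone I"
  shows "(0, \<beta>) \<in> (simple_step 0)\<^sup>* \<and> (- \<beta>, 0) \<in> (simple_step 0)\<^sup>*"
  using finite_R assms
proof (induction \<beta> rule: finite_induct_smaller[where h = "height S"])
  case (less \<beta>)
  show ?case
  proof (cases "\<beta> = 0")
    case False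
    then obtain \<alpha> where \<alpha>: "\<alpha> \<in> I" "\<beta> - \<alpha> \<in> R" "\<beta> - \<alpha> \<in> nat_cone I"
      using positive_root_descent less.hyps less.prems by blast
    have "\<beta> \<in> fiber 0"
      using less nat_cone_subset_span[of I] by (auto simp: fiber_def)
    moreover have "\<beta> - \<alpha> \<in> fiber 0" by (rule fiber_diff_simple[OF calculation \<alpha>(2,1)])
    ultimately have step: "(\<beta> - \<alpha>, \<beta>) \<in> simple_step 0" "(- \<beta>, - (\<beta> - \<alpha>)) \<in> simple_step 0"
      using \<alpha>(1) uminus_fiber[of _ 0] by (force simp: simple_step_def)+
    have "height S (\<beta> - \<alpha>) < height S \<beta>"
      using \<alpha>(1) I_in_S
      by (simp add: linear_diff[OF linear_height] height_base independent_S)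
    with less.IH[OF \<alpha>(2) _ \<alpha>(3)] step show ?thesis
      by (meson converse_rtrancl_into_rtrancl rtrancl.rtrancl_into_rtrancl)
  qed simp
qed

lemma fiber_zero_hub:
  assumes "\<beta> \<in> fiber 0"
  shows "(0, \<beta>) \<in> (simple_step 0)\<^sup>* \<or> (\<beta>, 0) \<in> (simple_step 0)\<^sup>*"
proof -
  have "\<beta> \<in> R" "\<beta> \<in> span I" using assms by (auto simp: fiber_def)
  with root_sign positive_root_connected_zero[of \<beta>]
    positive_root_connected_zero[OF uminus_root[of \<beta>]]
  show ?thesis by auto
qed

lemma quotient_proj_eqI:
  assumes "x \<in> V" "z \<in> V" "z \<in> (span I)\<^sup>\<bottom>" "x - z \<in> span I"
  shows "quotient_proj V I x = z"
proof -
  let ?W = "V \<inter> (span I)\<^sup>\<bottom>"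
  have W: "subspace ?W"
    using span_R by (metis subspace_inter subspace_span subspace_orthogonal_comp)
  have "x - z \<in> ?W\<^sup>\<bottom>"
    using assms(4) by (auto simp: orthogonal_comp_def orthogonal_commute)
  with assms show ?thesis
    unfolding quotient_proj_def orth_proj_def
    by (intro the1_equality[OF orth_proj_ex1[OF W]]) auto
qed

lemma quotient_proj_decomp:
  assumes "x \<in> V"
  shows "quotient_proj V I x \<in> V" "quotient_proj V I x \<in> (span I)\<^sup>\<bottom>"
    "x - quotient_proj V I x \<in> span I"
proof -
  obtain y z where yz: "y \<in> span I" "\<And>w. w \<in> span I \<Longrightarrow> orthogonal z w" "x = y + z"
    by (rule orthogonal_subspace_decomp_exists[of I x]) blast
  have "span I \<subseteq> V" using span_S span_mono[OF I_subset] by simp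
  then have z: "z \<in> V"
    using yz(1,3) assms span_S span_diff[of x S y] by auto
  have "z \<in> (span I)\<^sup>\<bottom>"
    using yz(2) by (auto simp: orthogonal_comp_def orthogonal_commute)
  moreover from this have "quotient_proj V I x = z"
    using yz(1,3) by (intro quotient_proj_eqI assms z) auto
  ultimately show "quotient_proj V I x \<in> V" "quotient_proj V I x \<in> (span I)\<^sup>\<bottom>"
    "x - quotient_proj V I x \<in> span I"
    using yz z by auto
qed

lemma R_subset_V: "\<beta> \<in> R \<Longrightarrow> \<beta> \<in> V"
  using span_R span_base by auto

lemma quotient_root_orthogonal:
  assumes "\<nu> \<in> quotient_roots R V I"
  shows "\<nu> \<in> V" "\<nu> \<in> (span I)\<^sup>\<bottom>" "\<alpha> \<in> I \<Longrightarrow> \<nu> \<bullet> \<alpha> = 0"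
proof -
  show "\<nu> \<in> V" and orth: "\<nu> \<in> (span I)\<^sup>\<bottom>"
    using assms quotient_proj_decomp R_subset_V by (auto simp: quotient_roots_def)
  show "\<nu> \<bullet> \<alpha> = 0" if "\<alpha> \<in> I"
    using orth span_base[OF that] by (auto simp: orthogonal_comp_def orthogonal_def inner_commute)
qed

lemma root_fiber_eq:
  assumes "\<nu> \<in> quotient_roots R V I"
  shows "root_fiber R V I \<nu> = fiber \<nu>"
proof -
  have "quotient_proj V I \<beta> = \<nu> \<longleftrightarrow> \<beta> - \<nu> \<in> span I" if "\<beta> \<in> R" for \<beta>
    using quotient_proj_decomp(3) quotient_proj_eqI quotient_root_orthogonal[OF assms]
      R_subset_V[OF that] by blast
  then show ?thesis by (auto simp: root_fiber_def fiber_def)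
qed

lemma fiber_nonempty: "\<nu> \<in> quotient_roots R V I \<Longrightarrow> fiber \<nu> \<noteq> {}"
  by (auto simp: quotient_roots_def root_fiber_def simp flip: root_fiber_eq)

text \<open>An element strictly between would split a simple root into two nonzero cone elements.\<close>

lemma simple_step_hasse:
  "simple_step \<nu> \<subseteq> parcs (hasse_diagram (fiber \<nu>) (root_order R S))"
proof (rule subrelI)
  fix x y assume "(x, y) \<in> simple_step \<nu>"
  then have xy: "x \<in> fiber \<nu>" "y \<in> fiber \<nu>" "y - x \<in> I" by (auto simp: simple_step_def)
  have "0 \<notin> I" using independent_S I_subset dependent_zero by blast
  then have "x \<noteq> y" using xy(3) by auto
  moreover have "(x, y) \<in> root_order R S"
    using xy by (simp add: root_order_iff fiber_subset I_in_S base_in_nat_cone finite_S)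
  moreover have "z = x \<or> z = y" if "(x, z) \<in> root_order R S" "(z, y) \<in> root_order R S" for z
    using nat_cone_atom[OF independent_S finite_S, of "z - x" "y - z"] that I_in_S[OF xy(3)]
    by (auto simp: root_order_iff)
  ultimately show "(x, y) \<in> parcs (hasse_diagram (fiber \<nu>) (root_order R S))"
    using xy by (auto simp: hasse_diagram_def)
qed

lemma hasse_connected:
  assumes c: "c \<in> fiber \<nu>"
    and hub: "\<And>\<beta>. \<beta> \<in> fiber \<nu> \<Longrightarrow> (c, \<beta>) \<in> (simple_step \<nu>)\<^sup>* \<or> (\<beta>, c) \<in> (simple_step \<nu>)\<^sup>*"
  shows "Digraph_Component.connected
           (with_proj (hasse_diagram (fiber \<nu>) (root_order R S)))"
    (is "Digraph_Component.connected (with_proj ?H)")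
proof -
  have verts: "pverts ?H = fiber \<nu>" by (simp add: hasse_diagram_def)
  let ?G = "with_proj (mk_symmetric ?H)"
  interpret H: pair_wf_digraph ?H
    by unfold_locales (auto simp: hasse_diagram_def)
  interpret G: wf_digraph ?G
    using H.wellformed_mk_symmetric by (simp only: wf_digraph_wp_iff)
  have sym: "y \<rightarrow>\<^sup>*\<^bsub>?G\<^esub> x" if "x \<rightarrow>\<^sup>*\<^bsub>?G\<^esub> y" for x y
    using symmetric_reachable[OF symmetric_mk_symmetric that] .
  have walk: "y \<in> fiber \<nu> \<and> x \<rightarrow>\<^sup>*\<^bsub>?G\<^esub> y" if "(x, y) \<in> (simple_step \<nu>)\<^sup>*" "x \<in> fiber \<nu>" for x y
    using that
  proof (induction rule: rtrancl_induct)
    case base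
    then show ?case by (simp add: verts)
  next
    case (step y z)
    then have "(y, z) \<in> parcs ?H" using simple_step_hasse by blast
    then have yz: "y \<rightarrow>\<^bsub>?G\<^esub> z" by (force simp: parcs_mk_symmetric)
    have "z \<in> fiber \<nu>" using step.hyps(2) by (auto simp: simple_step_def)
    moreover have "x \<rightarrow>\<^sup>*\<^bsub>?G\<^esub> y" using step.IH step.prems by simp
    from this yz have "x \<rightarrow>\<^sup>*\<^bsub>?G\<^esub> z" by (rule G.reachable_adj_trans)
    ultimately show ?case ..
  qed
  have from_c: "c \<rightarrow>\<^sup>*\<^bsub>?G\<^esub> \<beta>" if "\<beta> \<in> fiber \<nu>" for \<beta>
    using hub[OF that]
  proof
    assume "(c, \<beta>) \<in> (simple_step \<nu>)\<^sup>*"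
    from walk[OF this c] show ?thesis ..
  next
    assume "(\<beta>, c) \<in> (simple_step \<nu>)\<^sup>*"
    from walk[OF this that] show ?thesis using sym by simp
  qed
  have "x \<rightarrow>\<^sup>*\<^bsub>?G\<^esub> y" if "x \<in> fiber \<nu>" "y \<in> fiber \<nu>" for x y
    using G.reachable_trans[OF sym[OF from_c[OF that(1)]] from_c[OF that(2)]] .
  then show ?thesis
    unfolding connected_def strongly_connected_def using c by (auto simp: verts)
qed

lemma fiber_smallest:
  assumes "\<mu> \<in> fiber \<nu>" "\<forall>\<beta>\<in>fiber \<nu>. (\<mu>, \<beta>) \<in> (simple_step \<nu>)\<^sup>*"
  shows "smallest_in \<mu> (fiber \<nu>) (root_order R S)"
  unfolding smallest_in_def root_order_iff
proof (intro conjI ballI)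
  fix \<beta> assume "\<beta> \<in> fiber \<nu>"
  then have "\<beta> - \<mu> \<in> nat_cone I" using assms(2) simple_step_star_nat_cone by blast
  then show "\<beta> - \<mu> \<in> nat_cone S" using nat_cone_mono[OF finite_S I_subset] by blast
qed (use assms(1) fiber_subset in auto)

lemma uminus_smallest_largest:
  assumes "smallest_in \<mu> (fiber (- \<nu>)) (root_order R S)"
  shows "largest_in (- \<mu>) (fiber \<nu>) (root_order R S)"
proof -
  have "- \<mu> \<in> fiber \<nu>"
    using assms uminus_fiber[of \<mu> "- \<nu>"] by (simp add: smallest_in_def)
  moreover have "(\<beta>, - \<mu>) \<in> root_order R S" if "\<beta> \<in> fiber \<nu>" for \<beta>
  proof -
    have "(\<mu>, - \<beta>) \<in> root_order R S"
      using assms uminus_fiber[OF that] by (simp add: smallest_in_def)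
    then show ?thesis
      using fiber_subset[OF that] uminus_root[of \<mu>]
      by (simp add: root_order_iff minus_diff_commute)
  qed
  ultimately show ?thesis by (simp add: largest_in_def)
qed

end

theorem corollary3p5:
  fixes R V S I :: "'a::euclidean_space set" and \<nu> :: 'a
  assumes "generalized_root_system R V"
    and "root_base S R V"
    and "I \<subseteq> S"
    and "\<nu> \<in> quotient_roots R V I"
  shows "Digraph_Component.connected
           (with_proj (hasse_diagram (root_fiber R V I \<nu>) (root_order R S))) \<and>
         (\<nu> \<noteq> 0 \<longrightarrow>
           (\<exists>\<mu>. smallest_in \<mu> (root_fiber R V I \<nu>) (root_order R S)) \<and>
           (\<exists>\<mu>. largest_in \<mu> (root_fiber R V I \<nu>) (root_order R S)))"
proof -
  interpret based_root_system R V S I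
    using assms by unfold_locales
  note orth = quotient_root_orthogonal(3)[OF assms(4)]
  obtain \<beta> where \<beta>: "\<beta> \<in> fiber \<nu>" using fiber_nonempty[OF assms(4)] by blast
  show ?thesis
    unfolding root_fiber_eq[OF assms(4)]
  proof (cases "\<nu> = 0")
    case True
    have "0 \<in> fiber 0" by (simp add: fiber_def zero_root span_zero)
    from hasse_connected[OF this fiber_zero_hub] True
    show "Digraph_Component.connected (with_proj (hasse_diagram (fiber \<nu>) (root_order R S))) \<and>
      (\<nu> \<noteq> 0 \<longrightarrow> (\<exists>\<mu>. smallest_in \<mu> (fiber \<nu>) (root_order R S)) \<and>
        (\<exists>\<mu>. largest_in \<mu> (fiber \<nu>) (root_order R S)))" by simp
  next
    case False
    obtain \<mu> where \<mu>: "\<mu> \<in> fiber \<nu>" "\<forall>\<beta>\<in>fiber \<nu>. (\<mu>, \<beta>) \<in> (simple_step \<nu>)\<^sup>*"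
      using fiber_source[OF False orth \<beta>] by blast
    obtain \<mu>' where \<mu>': "\<mu>' \<in> fiber (- \<nu>)" "\<forall>\<beta>\<in>fiber (- \<nu>). (\<mu>', \<beta>) \<in> (simple_step (- \<nu>))\<^sup>*"
      using fiber_source[OF _ _ uminus_fiber[OF \<beta>]] False orth by auto
    show "Digraph_Component.connected (with_proj (hasse_diagram (fiber \<nu>) (root_order R S))) \<and>
      (\<nu> \<noteq> 0 \<longrightarrow> (\<exists>\<mu>. smallest_in \<mu> (fiber \<nu>) (root_order R S)) \<and>
        (\<exists>\<mu>. largest_in \<mu> (fiber \<nu>) (root_order R S)))"
      using hasse_connected[OF \<mu>(1)] fiber_smallest[OF \<mu>]
        uminus_smallest_largest[OF fiber_smallest[OF \<mu>']] \<mu>(2) by blast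
  qed
qed

end
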